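(* Let $\Pi$ be a protocol with block-proportional rewards with $R$ rewards per block, where each party's stake is $\mathcal{S}_P=\mu_P\cdot\mathcal{S}$, and let $\sigma_\Pi$ be the all-honest strategy profile. Let $\alpha$ be the security threshold w.r.t. an infraction predicate $\mathsf{IP}$. Assume that for every strategy profile $\sigma$ the exchange rate $X_\sigma$ w.r.t. $\mathsf{IP},\alpha$ is $$X_\sigma(\Im)=\begin{cases}x_{\max},&\text{if }\sum_{P\in\mathbb{P}:\mathsf{IP}(\Im,P)=1}\mu_P<\alpha\\ x_{\min},&\text{otherwise,}\end{cases}$$ the external rewards due to guided bribing w.r.t. $\mathsf{IP}$ are $B_{P,\sigma}(\Im)=\beta_P$ if $\mathsf{IP}(\Im,P)=1$ and $B_{P,\sigma}(\Im)=0$ otherwise, and the compliance payout (deposit) w.r.t. $\mathsf{IP}$ is $G_{P,\sigma}(\Im)=0$ if $\mathsf{IP}(\Im,P)=1$ and $G_{P,\sigma}(\Im)=\mu_P\cdot G$ otherwise. Assume that for every party $P\in\mathbb{P}$ it holds that (i) $\mu_P<\alpha$ and (ii) $\beta_P-\mu_P\cdot G\cdot x_{\max}\le\mathrm{negl}(\kappa)$. Then, for the utility Accountable Reward under $\mathcal{R}_{\text{sync}}$, it holds that $\mathsf{PSt}\le1+\mathrm{negl}(\kappa)$.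
   Context: Model. $\kappa$ is the security parameter; $\mathrm{negl}(\kappa)$ denotes a negligible function of $\kappa$. A Proof-of-Stake ledger protocol $\Pi$ is run by a finite set $\mathbb{P}$ of $n$ rational parties over $N$ time slots (rounds), $N$ polynomial in $\kappa$. Party $P$ holds a fraction $\mu_P\in[0,1]$ of the participation power, with $\sum_{P\in\mathbb{P}}\mu_P=1$. Before the execution each party picks a strategy from the set $\mathbb{S}$ of all efficient algorithms; a strategy profile $\sigma$ is the vector of all parties' strategies. $\Pi$ also denotes the honest strategy (following the protocol), and $\sigma_\Pi=\langle\Pi,\dots,\Pi\rangle$. An execution under $\sigma$ is a random process; a trace $\Im$ is its outcome for a fixed environment (which schedules activations and provides inputs), router, profile, and random coins. The synchronous router $\mathcal{R}_{\text{sync}}$ delivers every message at the end of the round in which it was created. Ledger and rewards. In each slot a leader and a committee of parties are elected; the leader may propose a block, committee members sign it if valid, and a party appends a block to its chain when it has signatures of committee members whose aggregate power exceeds a protocol-defined threshold (typically $2/3$ of the committee's power). At the end of the execution a passive, always-online observer outputs a chain. Block-proportional rewards with $R$ rewards per block: the ledger rewards of $P$ are $R_{P,\sigma}(\Im)=M_{P,\Im}\cdot R$, where $M_{P,\Im}$ is the number of blocks created by $P$ in the observer's chain. $M_{P,\sigma_\Pi}$ is the random number of blocks created by $P$ under $\sigma_\Pi$. Standing assumptions: under $\sigma_\Pi$ the total block rewards given by the system are maximized; exactly one block is created per slot; and for every $\theta\in(0,1)$, $\Pr[M_{P,\sigma_\Pi}\ge(1+\theta)E[M_{P,\sigma_\Pi}]]\le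 e^{-\frac{\theta^2}{3}E[M_{P,\sigma_\Pi}]}$ and $\Pr[M_{P,\sigma_\Pi}\le(1-\theta)E[M_{P,\sigma_\Pi}]]\le e^{-\frac{\theta^2}{2}E[M_{P,\sigma_\Pi}]}$. Infractions. An infraction predicate $\mathsf{IP}(\Im,P)\in\{0,1\}$ equals $1$ iff in $\Im$ party $P$ deviates from the protocol in a specified way within a time frame $\Delta$; it is always $0$ if $P$ follows $\Pi$. The infractions considered are safety infractions, in particular double signing (proposing or signing two blocks such that every chain containing both is invalid). The strategy $S_{\mathsf{IP}}$ performs the infraction whenever possible and behaves honestly otherwise. $\Delta$ is large enough that a party following $S_{\mathsf{IP}}$ fails to perform the infraction only with probability $\mathrm{negl}(\kappa)$. The security threshold $\alpha\in(0,1)$ is the power fraction such that, if parties with aggregate power at least $\alpha$ all follow $S_{\mathsf{IP}}$, the attack succeeds with probability $1-\mathrm{negl}(\kappa)$. Utility. $\mathcal{S}$ is the total stake, $\mathcal{S}_P$ the stake of $P$; $G>0$ is the aggregate deposit (or dilution reward) amount; $x_{\max}>x_{\min}\ge0$ are constants; the bribes $\beta_P\ge 0$ are real numbers. The utility Accountable Reward is $U_P(\sigma)=E[\mathcal{S}_P\cdot X_\sigma]+E[R_{P,\sigma}\cdot X_\sigma]+E[B_{P,\sigma}]+E[G_{P,\sigma}\cdot X_\sigma]$. Equilibrium and price of stability. A profile $\sigma^*=(S^*_i,S^*_{-i})$ is an $\epsilon$-Nash equilibrium if for every party $P_i$ and every $S_i\in\mathbb{S}\setminus\{S_i^*\}$: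 $U_{P_i}(S_i^*,S_{-i}^* )\ge U_{P_i}(S_i,S_{-i}^* )-\epsilon$. $\mathbb{EQ}$ is the set of all $\mathrm{negl}(\kappa)$-Nash equilibria. The welfare is $\mathsf{Welf}(\sigma)=\sum_{P\in\mathbb{P}}U_P(\sigma)$ and the Price of Stability is $\mathsf{PSt}=\dfrac{\max_{\sigma\in\mathbb{S}^n}\mathsf{Welf}(\sigma)}{\max_{\sigma\in\mathbb{EQ}}\mathsf{Welf}(\sigma)}$. *)

theory Defs
  imports "HOL-Probability.Probability"
begin

definition negl :: "(nat \<Rightarrow> real) \<Rightarrow> bool" where
  "negl f \<longleftrightarrow> (\<forall>c::nat. \<forall>\<^sub>F \<kappa> in at_top. \<bar>f \<kappa>\<bar> < 1 / real \<kappa> ^ c)"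

definition polynomially_bounded :: "(nat \<Rightarrow> nat) \<Rightarrow> bool" where
  "polynomially_bounded f \<longleftrightarrow> (\<exists>c::nat. (\<lambda>\<kappa>. real (f \<kappa>)) \<in> O(\<lambda>\<kappa>. real \<kappa> ^ c))"


section \<open>Games indexed by the security parameter\<close>

text \<open>
  A profile assigns a strategy to every element of the (finite) type of parties. A strategy is
  uniform in the security parameter, so a utility maps the parameter, a profile and a party to a
  real number, and equilibria are subsets of the profiles that do not depend on the parameter.
\<close>

definition profiles :: "'s set \<Rightarrow> ('p \<Rightarrow> 's) set" where
  "profiles \<S> = {\<sigma>. \<forall>P. \<sigma> P \<in> \<S>}"

definition nash_equilibrium ::
  "'s set \<Rightarrow> (nat \<Rightarrow> ('p \<Rightarrow> 's) \<Rightarrow> 'p \<Rightarrow> real) \<Rightarrow> (nat \<Rightarrow> real) \<Rightarrow> ('p \<Rightarrow> 's) \<Rightarrow> bool" where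
  "nash_equilibrium \<S> U \<epsilon> \<sigma> \<longleftrightarrow>
     (\<forall>\<kappa> P. \<forall>S \<in> \<S> - {\<sigma> P}. U \<kappa> \<sigma> P \<ge> U \<kappa> (\<sigma>(P := S)) P - \<epsilon> \<kappa>)"

definition negl_equilibria ::
  "'s set \<Rightarrow> (nat \<Rightarrow> ('p \<Rightarrow> 's) \<Rightarrow> 'p \<Rightarrow> real) \<Rightarrow> ('p \<Rightarrow> 's) set" where
  "negl_equilibria \<S> U = {\<sigma> \<in> profiles \<S>. \<exists>\<epsilon>. negl \<epsilon> \<and> nash_equilibrium \<S> U \<epsilon> \<sigma>}"

definition welfare ::
  "(nat \<Rightarrow> ('p::finite \<Rightarrow> 's) \<Rightarrow> 'p \<Rightarrow> real) \<Rightarrow> nat \<Rightarrow> ('p \<Rightarrow> 's) \<Rightarrow> real" where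
  "welfare U \<kappa> \<sigma> = (\<Sum>P\<in>UNIV. U \<kappa> \<sigma> P)"

text \<open>
  The maxima range over possibly infinite sets of profiles and are therefore rendered as suprema
  (which are the maxima whenever these are attained).
\<close>

definition price_of_stability ::
  "'s set \<Rightarrow> (nat \<Rightarrow> ('p::finite \<Rightarrow> 's) \<Rightarrow> 'p \<Rightarrow> real) \<Rightarrow> nat \<Rightarrow> real" where
  "price_of_stability \<S> U \<kappa> =
     (SUP \<sigma>\<in>profiles \<S>. welfare U \<kappa> \<sigma>) / (SUP \<sigma>\<in>negl_equilibria \<S> U. welfare U \<kappa> \<sigma>)"


section \<open>Executions of a ledger protocol\<close>

datatype ('p, 'd) block = Block (slot: nat) (creator: 'p) (content: 'd)

datatype ('p, 'd, 'x) msg =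
    Propose "('p, 'd) block"
  | Sign "('p, 'd) block"
  | Aux 'x

text \<open>The leader and the committee elected for a slot.\<close>

type_synonym 'p election = "'p \<times> 'p set"

text \<open>
  The input is \<^const>\<open>None\<close> if the environment does not activate the party in the round. Messages
  are authenticated: a delivery consists of the sender and the message. The recipient
  \<^const>\<open>None\<close> is the passive observer.
\<close>

record ('p, 'd, 'x, 'i) round =
  input :: "'p \<Rightarrow> 'i option"
  sent :: "'p \<Rightarrow> ('p, 'd, 'x) msg set"
  received :: "'p option \<Rightarrow> ('p \<times> ('p, 'd, 'x) msg) set"

record ('p, 'd, 'x, 'i) trace =
  schedule :: "'p election list"
  rounds :: "('p, 'd, 'x, 'i) round list"

text \<open>
  What a party knows when it is activated: the elections up to the current slot, its own inputs and
  its sent and received messages in all past rounds, and its current input.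
\<close>

record ('p, 'd, 'x, 'i) view =
  elections :: "'p election list"
  past :: "('i option \<times> ('p, 'd, 'x) msg set \<times> ('p \<times> ('p, 'd, 'x) msg) set) list"
  now :: 'i

text \<open>
  A strategy maps the security parameter, the identity of the party running it, its private coins
  and its view to the messages created upon activation.
\<close>

type_synonym ('p, 'd, 'x, 'i, 'r) strategy =
  "nat \<Rightarrow> 'p \<Rightarrow> 'r \<Rightarrow> ('p, 'd, 'x, 'i) view \<Rightarrow> ('p, 'd, 'x) msg set"

text \<open>
  The random coins of an execution: the outcome of the leader and committee lottery for each slot,
  and the private coins of the parties (\<^term>\<open>Some P\<close>) and of the environment (\<^const>\<open>None\<close>).
\<close>

record ('p, 'r) coins =
  lottery :: "nat \<Rightarrow> 'p election"
  tape :: "'p option \<Rightarrow> 'r"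

text \<open>
  Given the past rounds and the messages created in the current round by every party, a router
  determines what each recipient gets at the end of the current round.
\<close>

type_synonym ('p, 'd, 'x, 'i) router =
  "('p, 'd, 'x, 'i) round list \<Rightarrow> ('p \<Rightarrow> ('p, 'd, 'x) msg set) \<Rightarrow>
     'p option \<Rightarrow> ('p \<times> ('p, 'd, 'x) msg) set"

definition sync_router :: "('p, 'd, 'x, 'i) router" where
  "sync_router rs out recipient = {(Q, m). m \<in> out Q}"

text \<open>
  \<open>mu P\<close> is the fraction of the participation power held by \<open>P\<close>.
  A slot lasts \<open>slot_len\<close> rounds, so that the
  signatures on a block can be created in the slot of
  the block even though messages are delivered only at the end of a round. Since only finitely many
  coins are tossed in an execution, their distribution is discrete; it is otherwise arbitrary, so
  that private coins may be correlated with the lottery. \<open>strategies\<close> is the class of admissible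
  (efficient) algorithms, \<open>quorum C\<close> is the power that the signatures of members of a committee
  \<open>C\<close> have to exceed, and \<open>select\<close> is the rule by which the observer determines its chain from the
  elections and from the messages it received in each round.
\<close>

record ('p, 'd, 'x, 'i, 'r) ledger =
  mu :: "'p \<Rightarrow> real"
  slots :: "nat \<Rightarrow> nat"
  slot_len :: nat
  coins :: "nat \<Rightarrow> ('p, 'r) coins pmf"
  environment ::
    "nat \<Rightarrow> 'r \<Rightarrow> 'p election list \<Rightarrow> ('p, 'd, 'x, 'i) round list \<Rightarrow> 'p \<Rightarrow> 'i option"
  router :: "('p, 'd, 'x, 'i) router"
  strategies :: "('p, 'd, 'x, 'i, 'r) strategy set"
  honest :: "('p, 'd, 'x, 'i, 'r) strategy"
  quorum :: "'p set \<Rightarrow> real"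
  valid :: "nat \<Rightarrow> ('p, 'd) block list \<Rightarrow> bool"
  select ::
    "nat \<Rightarrow> 'p election list \<Rightarrow> ('p \<times> ('p, 'd, 'x) msg) set list \<Rightarrow> ('p, 'd) block list"

definition num_rounds :: "('p, 'd, 'x, 'i, 'r) ledger \<Rightarrow> nat \<Rightarrow> nat" where
  "num_rounds L \<kappa> = slots L \<kappa> * slot_len L"

definition view_of ::
  "('p, 'd, 'x, 'i, 'r) ledger \<Rightarrow> 'p election list \<Rightarrow> ('p, 'd, 'x, 'i) round list \<Rightarrow> 'p \<Rightarrow> 'i \<Rightarrow>
     ('p, 'd, 'x, 'i) view" where
  "view_of L es rs P i =
     \<lparr>elections = take (Suc (length rs div slot_len L)) es,
      past = map (\<lambda>r. (input r P, sent r P, received r (Some P))) rs,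
      now = i\<rparr>"

definition respond ::
  "('p, 'd, 'x, 'i, 'r) ledger \<Rightarrow> ('p, 'd, 'x, 'i, 'r) strategy \<Rightarrow> nat \<Rightarrow> ('p, 'r) coins \<Rightarrow>
     'p election list \<Rightarrow> ('p, 'd, 'x, 'i) round list \<Rightarrow> ('p \<Rightarrow> 'i option) \<Rightarrow> 'p \<Rightarrow>
     ('p, 'd, 'x) msg set" where
  "respond L S \<kappa> \<omega> es rs inp P =
     (case inp P of
        None \<Rightarrow> {}
      | Some i \<Rightarrow> S \<kappa> P (tape \<omega> (Some P)) (view_of L es rs P i))"

definition next_round ::
  "('p, 'd, 'x, 'i, 'r) ledger \<Rightarrow> nat \<Rightarrow> ('p \<Rightarrow> ('p, 'd, 'x, 'i, 'r) strategy) \<Rightarrow> ('p, 'r) coins \<Rightarrow>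
     'p election list \<Rightarrow> ('p, 'd, 'x, 'i) round list \<Rightarrow> ('p, 'd, 'x, 'i) round" where
  "next_round L \<kappa> \<sigma> \<omega> es rs =
     (let inp = environment L \<kappa> (tape \<omega> None) (take (Suc (length rs div slot_len L)) es) rs;
          out = (\<lambda>P. respond L (\<sigma> P) \<kappa> \<omega> es rs inp P)
      in \<lparr>input = inp, sent = out, received = router L rs out\<rparr>)"

definition election_schedule ::
  "('p, 'd, 'x, 'i, 'r) ledger \<Rightarrow> nat \<Rightarrow> ('p, 'r) coins \<Rightarrow> 'p election list" where
  "election_schedule L \<kappa> \<omega> = map (lottery \<omega>) [0..<slots L \<kappa>]"

definition execution ::
  "('p, 'd, 'x, 'i, 'r) ledger \<Rightarrow> nat \<Rightarrow> ('p \<Rightarrow> ('p, 'd, 'x, 'i, 'r) strategy) \<Rightarrow> ('p, 'r) coins \<Rightarrow>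
     ('p, 'd, 'x, 'i) trace" where
  "execution L \<kappa> \<sigma> \<omega> =
     (let es = election_schedule L \<kappa> \<omega>
      in \<lparr>schedule = es,
          rounds = ((\<lambda>rs. rs @ [next_round L \<kappa> \<sigma> \<omega> es rs]) ^^ num_rounds L \<kappa>) []\<rparr>)"

definition trace_pmf ::
  "('p, 'd, 'x, 'i, 'r) ledger \<Rightarrow> nat \<Rightarrow> ('p \<Rightarrow> ('p, 'd, 'x, 'i, 'r) strategy) \<Rightarrow>
     ('p, 'd, 'x, 'i) trace pmf" where
  "trace_pmf L \<kappa> \<sigma> = map_pmf (execution L \<kappa> \<sigma>) (coins L \<kappa>)"

abbreviation expect ::
  "('p, 'd, 'x, 'i, 'r) ledger \<Rightarrow> nat \<Rightarrow> ('p \<Rightarrow> ('p, 'd, 'x, 'i, 'r) strategy) \<Rightarrow>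
     (('p, 'd, 'x, 'i) trace \<Rightarrow> real) \<Rightarrow> real" where
  "expect L \<kappa> \<sigma> f \<equiv> measure_pmf.expectation (trace_pmf L \<kappa> \<sigma>) f"

abbreviation pr ::
  "('p, 'd, 'x, 'i, 'r) ledger \<Rightarrow> nat \<Rightarrow> ('p \<Rightarrow> ('p, 'd, 'x, 'i, 'r) strategy) \<Rightarrow>
     (('p, 'd, 'x, 'i) trace \<Rightarrow> bool) \<Rightarrow> real" where
  "pr L \<kappa> \<sigma> A \<equiv> measure_pmf.prob (trace_pmf L \<kappa> \<sigma>) {tr. A tr}"

abbreviation all_honest ::
  "('p, 'd, 'x, 'i, 'r) ledger \<Rightarrow> 'p \<Rightarrow> ('p, 'd, 'x, 'i, 'r) strategy" where
  "all_honest L \<equiv> (\<lambda>P. honest L)"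


section \<open>Chains and block rewards\<close>

text \<open>
  A block counts as certified, relative to a set of received messages, if it was proposed by the
  elected leader of its slot and signed by sufficiently powerful members of the slot's committee.
\<close>

definition certified ::
  "('p, 'd, 'x, 'i, 'r) ledger \<Rightarrow> 'p election list \<Rightarrow> ('p \<times> ('p, 'd, 'x) msg) set \<Rightarrow>
     ('p, 'd) block \<Rightarrow> bool" where
  "certified L es D b \<longleftrightarrow>
     slot b < length es \<and>
     creator b = fst (es ! slot b) \<and>
     (creator b, Propose b) \<in> D \<and>
     (\<Sum>Q\<in>{Q \<in> snd (es ! slot b). (Q, Sign b) \<in> D}. mu L Q) > quorum L (snd (es ! slot b))"

definition acceptable_chain ::
  "('p, 'd, 'x, 'i, 'r) ledger \<Rightarrow> nat \<Rightarrow> 'p election list \<Rightarrow> ('p \<times> ('p, 'd, 'x) msg) set \<Rightarrow>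
     ('p, 'd) block list \<Rightarrow> bool" where
  "acceptable_chain L \<kappa> es D bs \<longleftrightarrow>
     valid L \<kappa> bs \<and> sorted_wrt (<) (map slot bs) \<and> (\<forall>b\<in>set bs. certified L es D b)"

definition observer_chain ::
  "('p, 'd, 'x, 'i, 'r) ledger \<Rightarrow> nat \<Rightarrow> ('p, 'd, 'x, 'i) trace \<Rightarrow> ('p, 'd) block list" where
  "observer_chain L \<kappa> tr = select L \<kappa> (schedule tr) (map (\<lambda>r. received r None) (rounds tr))"

definition blocks_created ::
  "('p, 'd, 'x, 'i, 'r) ledger \<Rightarrow> nat \<Rightarrow> ('p, 'd, 'x, 'i) trace \<Rightarrow> 'p \<Rightarrow> nat" where
  "blocks_created L \<kappa> tr P = length (filter (\<lambda>b. creator b = P) (observer_chain L \<kappa> tr))"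

definition block_rewards ::
  "('p, 'd, 'x, 'i, 'r) ledger \<Rightarrow> real \<Rightarrow> nat \<Rightarrow> ('p, 'd, 'x, 'i) trace \<Rightarrow> 'p \<Rightarrow> real" where
  "block_rewards L R \<kappa> tr P = real (blocks_created L \<kappa> tr P) * R"

definition ledger_protocol :: "('p::finite, 'd, 'x, 'i, 'r) ledger \<Rightarrow> bool" where
  "ledger_protocol L \<longleftrightarrow>
     (\<forall>P. 0 \<le> mu L P \<and> mu L P \<le> 1) \<and>
     (\<Sum>P\<in>UNIV. mu L P) = 1 \<and>
     polynomially_bounded (slots L) \<and>
     slot_len L \<ge> 1 \<and>
     honest L \<in> strategies L \<and>
     (\<forall>\<kappa> es Ds. acceptable_chain L \<kappa> es (\<Union>(set Ds)) (select L \<kappa> es Ds))"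

text \<open>Standing assumptions on executions in which all parties are honest.\<close>

definition honest_execution_assumptions ::
  "('p::finite, 'd, 'x, 'i, 'r) ledger \<Rightarrow> real \<Rightarrow> bool" where
  "honest_execution_assumptions L R \<longleftrightarrow>
     (\<forall>\<kappa>. \<forall>\<sigma>\<in>profiles (strategies L).
        expect L \<kappa> \<sigma> (\<lambda>tr. \<Sum>P\<in>UNIV. block_rewards L R \<kappa> tr P)
        \<le> expect L \<kappa> (all_honest L) (\<lambda>tr. \<Sum>P\<in>UNIV. block_rewards L R \<kappa> tr P)) \<and>
     (\<forall>\<kappa>. \<forall>tr\<in>set_pmf (trace_pmf L \<kappa> (all_honest L)). \<forall>s<slots L \<kappa>.
        length (filter (\<lambda>b. slot b = s) (observer_chain L \<kappa> tr)) = 1) \<and>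
     (\<forall>\<kappa> P \<theta>. 0 < \<theta> \<and> \<theta> < 1 \<longrightarrow>
        (let m = expect L \<kappa> (all_honest L) (\<lambda>tr. real (blocks_created L \<kappa> tr P))
         in pr L \<kappa> (all_honest L) (\<lambda>tr. real (blocks_created L \<kappa> tr P) \<ge> (1 + \<theta>) * m)
              \<le> exp (- (\<theta>\<^sup>2 / 3) * m) \<and>
            pr L \<kappa> (all_honest L) (\<lambda>tr. real (blocks_created L \<kappa> tr P) \<le> (1 - \<theta>) * m)
              \<le> exp (- (\<theta>\<^sup>2 / 2) * m)))"


section \<open>Infractions\<close>

definition deviates ::
  "('p, 'd, 'x, 'i, 'r) ledger \<Rightarrow> nat \<Rightarrow> ('p, 'r) coins \<Rightarrow> ('p, 'd, 'x, 'i) trace \<Rightarrow> 'p \<Rightarrow> nat \<Rightarrow>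
     bool" where
  "deviates L \<kappa> \<omega> tr P t \<longleftrightarrow>
     t < length (rounds tr) \<and>
     sent (rounds tr ! t) P \<noteq>
       respond L (honest L) \<kappa> \<omega> (schedule tr) (take t (rounds tr)) (input (rounds tr ! t)) P"

text \<open>
  The predicate \<open>IP\<close> itself specifies the kind of misbehaviour. It has to be a deviation from the
  protocol within the time frame \<open>\<Delta>\<close>, a set of rounds.
\<close>

definition infraction_predicate ::
  "('p, 'd, 'x, 'i, 'r) ledger \<Rightarrow> (nat \<Rightarrow> nat set) \<Rightarrow>
     (nat \<Rightarrow> ('p, 'd, 'x, 'i) trace \<Rightarrow> 'p \<Rightarrow> bool) \<Rightarrow> bool" where
  "infraction_predicate L \<Delta> IP \<longleftrightarrow>
     (\<forall>\<kappa>. \<forall>\<sigma>\<in>profiles (strategies L). \<forall>\<omega>\<in>set_pmf (coins L \<kappa>). \<forall>P.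
        (IP \<kappa> (execution L \<kappa> \<sigma> \<omega>) P \<longrightarrow>
           (\<exists>t\<in>\<Delta> \<kappa>. deviates L \<kappa> \<omega> (execution L \<kappa> \<sigma> \<omega>) P t)) \<and>
        (\<sigma> P = honest L \<longrightarrow> \<not> IP \<kappa> (execution L \<kappa> \<sigma> \<omega>) P))"

text \<open>
  A party with view \<open>v\<close> performs the infraction by creating the messages \<open>ms\<close> if it thereby
  satisfies the infraction predicate, no matter how the execution looks outside its view and how it
  continues.
\<close>

definition performs_infraction ::
  "('p, 'd, 'x, 'i, 'r) ledger \<Rightarrow> (nat \<Rightarrow> nat set) \<Rightarrow>
     (nat \<Rightarrow> ('p, 'd, 'x, 'i) trace \<Rightarrow> 'p \<Rightarrow> bool) \<Rightarrow> nat \<Rightarrow> 'p \<Rightarrow> ('p, 'd, 'x, 'i) view \<Rightarrow>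
     ('p, 'd, 'x) msg set \<Rightarrow> bool" where
  "performs_infraction L \<Delta> IP \<kappa> P v ms \<longleftrightarrow>
     (let t = length (past v)
      in t \<in> \<Delta> \<kappa> \<and> t < num_rounds L \<kappa> \<and>
         (\<forall>tr. length (schedule tr) = slots L \<kappa> \<and> length (rounds tr) = num_rounds L \<kappa> \<and>
               view_of L (schedule tr) (take t (rounds tr)) P (now v) = v \<and>
               input (rounds tr ! t) P = Some (now v) \<and> sent (rounds tr ! t) P = ms
               \<longrightarrow> IP \<kappa> tr P))"

text \<open>
  The strategy that performs the infraction whenever possible and is honest otherwise. The last
  conjunct says that the time frame is large enough.
\<close>

definition infraction_strategy ::
  "('p, 'd, 'x, 'i, 'r) ledger \<Rightarrow> (nat \<Rightarrow> nat set) \<Rightarrow>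
     (nat \<Rightarrow> ('p, 'd, 'x, 'i) trace \<Rightarrow> 'p \<Rightarrow> bool) \<Rightarrow> ('p, 'd, 'x, 'i, 'r) strategy \<Rightarrow> bool" where
  "infraction_strategy L \<Delta> IP S_IP \<longleftrightarrow>
     S_IP \<in> strategies L \<and>
     (\<forall>\<kappa> P r v.
        if \<exists>ms. performs_infraction L \<Delta> IP \<kappa> P v ms
        then performs_infraction L \<Delta> IP \<kappa> P v (S_IP \<kappa> P r v)
        else S_IP \<kappa> P r v = honest L \<kappa> P r v) \<and>
     (\<forall>\<sigma>\<in>profiles (strategies L). \<forall>P. \<sigma> P = S_IP \<longrightarrow>
        negl (\<lambda>\<kappa>. pr L \<kappa> \<sigma> (\<lambda>tr. \<not> IP \<kappa> tr P)))"

text \<open>The predicate \<open>attack\<close> holds of the traces on which the attack succeeds.\<close>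

definition security_threshold ::
  "('p::finite, 'd, 'x, 'i, 'r) ledger \<Rightarrow> ('p, 'd, 'x, 'i, 'r) strategy \<Rightarrow>
     (nat \<Rightarrow> ('p, 'd, 'x, 'i) trace \<Rightarrow> bool) \<Rightarrow> real \<Rightarrow> bool" where
  "security_threshold L S_IP attack \<alpha> \<longleftrightarrow>
     0 < \<alpha> \<and> \<alpha> < 1 \<and>
     (\<forall>\<sigma>\<in>profiles (strategies L). \<forall>A. (\<Sum>P\<in>A. mu L P) \<ge> \<alpha> \<and> (\<forall>P\<in>A. \<sigma> P = S_IP) \<longrightarrow>
        negl (\<lambda>\<kappa>. pr L \<kappa> \<sigma> (\<lambda>tr. \<not> attack \<kappa> tr)))"


section \<open>Utility\<close>

text \<open>
  \<open>X\<close>, \<open>B\<close> and \<open>G\<close> are the exchange rate, the external rewards and the compliance payouts; like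
  the ledger rewards they are functions of the trace for each security parameter and profile.
\<close>

definition accountable_reward ::
  "('p, 'd, 'x, 'i, 'r) ledger \<Rightarrow> ('p \<Rightarrow> real) \<Rightarrow> real \<Rightarrow>
     (nat \<Rightarrow> ('p \<Rightarrow> ('p, 'd, 'x, 'i, 'r) strategy) \<Rightarrow> ('p, 'd, 'x, 'i) trace \<Rightarrow> real) \<Rightarrow>
     (nat \<Rightarrow> 'p \<Rightarrow> ('p \<Rightarrow> ('p, 'd, 'x, 'i, 'r) strategy) \<Rightarrow> ('p, 'd, 'x, 'i) trace \<Rightarrow> real) \<Rightarrow>
     (nat \<Rightarrow> 'p \<Rightarrow> ('p \<Rightarrow> ('p, 'd, 'x, 'i, 'r) strategy) \<Rightarrow> ('p, 'd, 'x, 'i) trace \<Rightarrow> real) \<Rightarrow>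
     nat \<Rightarrow> ('p \<Rightarrow> ('p, 'd, 'x, 'i, 'r) strategy) \<Rightarrow> 'p \<Rightarrow> real" where
  "accountable_reward L party_stake R X B G \<kappa> \<sigma> P =
     expect L \<kappa> \<sigma> (\<lambda>tr. party_stake P * X \<kappa> \<sigma> tr) +
     expect L \<kappa> \<sigma> (\<lambda>tr. block_rewards L R \<kappa> tr P * X \<kappa> \<sigma> tr) +
     expect L \<kappa> \<sigma> (\<lambda>tr. B \<kappa> P \<sigma> tr) +
     expect L \<kappa> \<sigma> (\<lambda>tr. G \<kappa> P \<sigma> tr * X \<kappa> \<sigma> tr)"

end

theory Submission imports Defs begin

text \<open>
  In every slot only the elected leader can get a block into the observer's chain, and the elections
  do not depend on the strategies; as honest executions yield a block in each slot, the honest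
  profile gives every party, for each outcome of the coins, the largest possible number of blocks.
  It also attains the largest exchange rate, and a bribe exceeds the forfeited deposit at most
  negligibly. Hence the all-honest profile is, up to a negligible amount, the best profile for every
  single party: it is an equilibrium and nearly optimal, and its welfare is at least
  \<open>x_max * deposit > 0\<close>.
\<close>

section \<open>Closure properties of negligible functions\<close>

lemma negl_0: "negl (\<lambda>\<kappa>. 0)"
  unfolding negl_def
proof
  fix c :: nat
  show "\<forall>\<^sub>F \<kappa> in at_top. \<bar>0 :: real\<bar> < 1 / real \<kappa> ^ c"
    using eventually_gt_at_top[of 0] by eventually_elim simp
qed

lemma negl_abs: "negl f \<Longrightarrow> negl (\<lambda>\<kappa>. \<bar>f \<kappa>\<bar>)"
  by (simp add: negl_def)

text \<open>A spare power of \<kappa> absorbs the constant: \<open>f\<close> is bounded with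
  exponent \<open>Suc c\<close>, and eventually \<bar>K\<bar> < \<kappa>.\<close>

lemma negl_mult_const:
  assumes "negl f"
  shows "negl (\<lambda>\<kappa>. K * f \<kappa>)"
  unfolding negl_def
proof
  fix c :: nat
  have "\<forall>\<^sub>F \<kappa> in at_top. \<bar>f \<kappa>\<bar> < 1 / real \<kappa> ^ Suc c"
    using assms unfolding negl_def by blast
  moreover have "\<forall>\<^sub>F \<kappa> in at_top. \<bar>K\<bar> < real \<kappa>"
    using filterlim_real_sequentially by (simp add: filterlim_at_top_dense)
  ultimately show "\<forall>\<^sub>F \<kappa> in at_top. \<bar>K * f \<kappa>\<bar> < 1 / real \<kappa> ^ c"
  proof eventually_elim
    case (elim \<kappa>)
    then have pos: "real \<kappa> > 0" by linarith
    have "\<bar>K * f \<kappa>\<bar> \<le> real \<kappa> * \<bar>f \<kappa>\<bar>"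
      using elim by (simp add: abs_mult mult_right_mono)
    also have "\<dots> < real \<kappa> * (1 / real \<kappa> ^ Suc c)"
      using elim pos by (intro mult_strict_left_mono)
    also have "\<dots> = 1 / real \<kappa> ^ c"
      using pos by simp
    finally show ?case .
  qed
qed

lemma negl_add:
  assumes "negl f" "negl g"
  shows "negl (\<lambda>\<kappa>. f \<kappa> + g \<kappa>)"
proof -
  have "negl (\<lambda>\<kappa>. 1 / 2 * (2 * f \<kappa> + 2 * g \<kappa>))"
  proof (rule negl_mult_const)
    show "negl (\<lambda>\<kappa>. 2 * f \<kappa> + 2 * g \<kappa>)"
      unfolding negl_def
    proof
      fix c :: nat
      \<comment> \<open>\<open>2 * f\<close> plus \<open>2 * g\<close> is the mean of
        \<open>4 * f\<close> and \<open>4 * g\<close>, so it obeys any bound that both of these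
        obey.\<close>
      have "\<forall>\<^sub>F \<kappa> in at_top. \<bar>4 * f \<kappa>\<bar> < 1 / real \<kappa> ^ c"
        using negl_mult_const[OF assms(1)] unfolding negl_def by blast
      moreover have "\<forall>\<^sub>F \<kappa> in at_top. \<bar>4 * g \<kappa>\<bar> < 1 / real \<kappa> ^ c"
        using negl_mult_const[OF assms(2)] unfolding negl_def by blast
      ultimately show "\<forall>\<^sub>F \<kappa> in at_top. \<bar>2 * f \<kappa> + 2 * g \<kappa>\<bar> < 1 / real \<kappa> ^ c"
        by eventually_elim linarith
    qed
  qed
  then show ?thesis by (simp add: algebra_simps)
qed

lemma negl_sum:
  assumes "\<And>i. i \<in> A \<Longrightarrow> negl (f i)"
  shows "negl (\<lambda>\<kappa>. \<Sum>i\<in>A. f i \<kappa>)"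
  using assms by (induction A rule: infinite_finite_induct) (auto intro: negl_0 negl_add)

section \<open>Price of stability of a game with a profile that is nearly best for everyone\<close>

text \<open>The hypothesis \<open>best\<close> compares \<sigma>0 with all profiles, not only with
  unilateral deviations. It therefore yields both the equilibrium property and, summed over the
  parties, near-optimal welfare. The bound \<open>c\<close> does not depend on \<kappa>, so dividing
  the total error by the welfare keeps it negligible.\<close>

lemma price_of_stability_le:
  fixes U :: "nat \<Rightarrow> ('p::finite \<Rightarrow> 's) \<Rightarrow> 'p \<Rightarrow> real"
  assumes \<sigma>0: "\<sigma>0 \<in> profiles \<S>"
    and best: "\<And>\<kappa> \<sigma> P. \<sigma> \<in> profiles \<S> \<Longrightarrow> U \<kappa> \<sigma> P \<le> U \<kappa> \<sigma>0 P + \<epsilon> P \<kappa>"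
    and negl: "\<And>P. negl (\<epsilon> P)" and nonneg: "\<And>P \<kappa>. 0 \<le> \<epsilon> P \<kappa>"
    and welf: "\<And>\<kappa>. c \<le> welfare U \<kappa> \<sigma>0" and c: "c > 0"
  shows "\<exists>\<nu>. negl \<nu> \<and> (\<forall>\<kappa>. price_of_stability \<S> U \<kappa> \<le> 1 + \<nu> \<kappa>)"
proof -
  define \<eta> where "\<eta> \<kappa> = (\<Sum>P\<in>UNIV. \<epsilon> P \<kappa>)" for \<kappa>
  have negl_\<eta>: "negl \<eta>"
    unfolding \<eta>_def using negl by (rule negl_sum)
  \<comment> \<open>An equilibrium has one error for all parties; the sum of the nonnegative
    individual errors serves as such.\<close>
  have \<epsilon>_le: "\<epsilon> P \<kappa> \<le> \<eta> \<kappa>" for P \<kappa>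
    unfolding \<eta>_def using nonneg by (intro member_le_sum) auto
  have \<eta>_nonneg: "0 \<le> \<eta> \<kappa>" for \<kappa>
    unfolding \<eta>_def using nonneg by (intro sum_nonneg)
  have "nash_equilibrium \<S> U \<eta> \<sigma>0"
    unfolding nash_equilibrium_def
  proof (intro allI ballI)
    fix \<kappa> P S
    assume "S \<in> \<S> - {\<sigma>0 P}"
    with \<sigma>0 have "\<sigma>0(P := S) \<in> profiles \<S>"
      by (auto simp: profiles_def)
    from best[OF this, of \<kappa> P] \<epsilon>_le[of P \<kappa>]
    show "U \<kappa> \<sigma>0 P \<ge> U \<kappa> (\<sigma>0(P := S)) P - \<eta> \<kappa>" by linarith
  qed
  with negl_\<eta> \<sigma>0 have eq: "\<sigma>0 \<in> negl_equilibria \<S> U"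
    by (auto simp: negl_equilibria_def)
  have "price_of_stability \<S> U \<kappa> \<le> 1 + 1 / c * \<eta> \<kappa>" for \<kappa>
  proof -
    have W: "welfare U \<kappa> \<sigma> \<le> welfare U \<kappa> \<sigma>0 + \<eta> \<kappa>" if "\<sigma> \<in> profiles \<S>" for \<sigma>
      unfolding welfare_def \<eta>_def sum.distrib[symmetric]
      using best[OF that] by (intro sum_mono)
    have num: "(SUP \<sigma>\<in>profiles \<S>. welfare U \<kappa> \<sigma>) \<le> welfare U \<kappa> \<sigma>0 + \<eta> \<kappa>"
      using \<sigma>0 W by (intro cSUP_least) auto
    \<comment> \<open>A real supremum is an upper bound only of a set that is bounded above.
      Equilibria are profiles, so \<open>W\<close> bounds their welfare too.\<close>
    have "bdd_above (welfare U \<kappa> ` negl_equilibria \<S> U)"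
      using W by (intro bdd_aboveI2[of _ _ "welfare U \<kappa> \<sigma>0 + \<eta> \<kappa>"])
        (auto simp: negl_equilibria_def)
    with eq have den: "welfare U \<kappa> \<sigma>0 \<le> (SUP \<sigma>\<in>negl_equilibria \<S> U. welfare U \<kappa> \<sigma>)"
      by (intro cSUP_upper)
    have pos: "0 < welfare U \<kappa> \<sigma>0"
      using welf[of \<kappa>] c by linarith
    have "price_of_stability \<S> U \<kappa> \<le> (welfare U \<kappa> \<sigma>0 + \<eta> \<kappa>) / welfare U \<kappa> \<sigma>0"
      unfolding price_of_stability_def
      using num den pos \<eta>_nonneg[of \<kappa>] by (intro frac_le) auto
    also have "\<dots> = 1 + \<eta> \<kappa> / welfare U \<kappa> \<sigma>0"
      using pos by (simp add: field_simps)
    also have "\<dots> \<le> 1 + \<eta> \<kappa> / c"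
      using welf[of \<kappa>] c \<eta>_nonneg[of \<kappa>] by (simp add: divide_left_mono pos)
    finally show ?thesis by simp
  qed
  with negl_mult_const[OF negl_\<eta>] show ?thesis by blast
qed

section \<open>Blocks in the observer's chain and slots led by a party\<close>

lemma schedule_execution: "schedule (execution L \<kappa> \<sigma> \<omega>) = election_schedule L \<kappa> \<omega>"
  by (simp add: execution_def Let_def)

text \<open>No strategy profile occurs here: once the coins are fixed, this set is a common
  benchmark for all profiles.\<close>

definition slots_led ::
  "('p, 'd, 'x, 'i, 'r) ledger \<Rightarrow> nat \<Rightarrow> ('p, 'r) coins \<Rightarrow> 'p \<Rightarrow> nat set" where
  "slots_led L \<kappa> \<omega> P = {s. s < slots L \<kappa> \<and> fst (lottery \<omega> s) = P}"

lemma observer_chain_sorted: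
  assumes "ledger_protocol L"
  shows "sorted_wrt (<) (map slot (observer_chain L \<kappa> tr))"
  using assms by (auto simp: ledger_protocol_def acceptable_chain_def observer_chain_def)

text \<open>Whatever the parties send, \<open>select\<close> returns only certified blocks, and
  certification ties the creator to the leader elected for the slot.\<close>

lemma observer_chain_leader:
  assumes "ledger_protocol L" "b \<in> set (observer_chain L \<kappa> (execution L \<kappa> \<sigma> \<omega>))"
  shows "slot b \<in> slots_led L \<kappa> \<omega> (creator b)"
proof -
  let ?es = "election_schedule L \<kappa> \<omega>"
  have "slot b < length ?es" "creator b = fst (?es ! slot b)"
    using assms unfolding ledger_protocol_def acceptable_chain_def observer_chain_def
      certified_def schedule_execution by blast+
  then show ?thesis
    by (simp add: slots_led_def election_schedule_def)
qed

text \<open>Slots increase strictly along the chain, so no two of its blocks share a slot and blocks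
  can be counted by their slots.\<close>

lemma blocks_created_eq_card:
  assumes "ledger_protocol L"
  shows "blocks_created L \<kappa> tr P = card (slot ` {b \<in> set (observer_chain L \<kappa> tr). creator b = P})"
proof -
  let ?bs = "filter (\<lambda>b. creator b = P) (observer_chain L \<kappa> tr)"
  have "sorted_wrt (<) (map slot ?bs)"
    using observer_chain_sorted[OF assms, of \<kappa> tr]
    by (simp add: sorted_wrt_map sorted_wrt_filter)
  then have "distinct (map slot ?bs)"
    by (simp add: strict_sorted_iff)
  from distinct_card[OF this] show ?thesis
    by (simp add: blocks_created_def)
qed

lemma finite_slots_led: "finite (slots_led L \<kappa> \<omega> P)"
  by (simp add: slots_led_def)

lemma blocks_created_le:
  assumes "ledger_protocol L"
  shows "blocks_created L \<kappa> (execution L \<kappa> \<sigma> \<omega>) P \<le> card (slots_led L \<kappa> \<omega> P)"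
  unfolding blocks_created_eq_card[OF assms]
  using observer_chain_leader[OF assms] by (intro card_mono finite_slots_led) auto

lemma card_slots_led_le: "card (slots_led L \<kappa> \<omega> P) \<le> slots L \<kappa>"
  using card_mono[of "{..<slots L \<kappa>}" "slots_led L \<kappa> \<omega> P"] by (auto simp: slots_led_def)

text \<open>The block found in each slot must stem from the leader of that slot, so no slot led by
  \<open>P\<close> is lost and the bound of \<open>blocks_created_le\<close> is attained. Equality
  holds for each outcome of the coins and each party, which is stronger than maximality of the
  expected total rewards.\<close>

lemma blocks_created_honest:
  assumes L: "ledger_protocol L" and honest: "honest_execution_assumptions L R"
    and \<omega>: "\<omega> \<in> set_pmf (coins L \<kappa>)"
  shows "blocks_created L \<kappa> (execution L \<kappa> (all_honest L) \<omega>) P = card (slots_led L \<kappa> \<omega> P)"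
proof -
  let ?tr = "execution L \<kappa> (all_honest L) \<omega>"
  have "?tr \<in> set_pmf (trace_pmf L \<kappa> (all_honest L))"
    using \<omega> by (simp add: trace_pmf_def)
  with honest have one: "length (filter (\<lambda>b. slot b = s) (observer_chain L \<kappa> ?tr)) = 1"
    if "s < slots L \<kappa>" for s
    using that unfolding honest_execution_assumptions_def by blast
  have "slots_led L \<kappa> \<omega> P \<subseteq> slot ` {b \<in> set (observer_chain L \<kappa> ?tr). creator b = P}"
  proof
    fix s
    assume s: "s \<in> slots_led L \<kappa> \<omega> P"
    then have "filter (\<lambda>b. slot b = s) (observer_chain L \<kappa> ?tr) \<noteq> []"
      using one[of s] by (auto simp: slots_led_def simp del: filter_empty_conv)
    then obtain b where b: "b \<in> set (observer_chain L \<kappa> ?tr)" "slot b = s"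
      by (auto simp: filter_empty_conv)
    with observer_chain_leader[OF L b(1)] s have "creator b = P"
      by (simp add: slots_led_def)
    with b show "s \<in> slot ` {b \<in> set (observer_chain L \<kappa> ?tr). creator b = P}"
      by blast
  qed
  then have "card (slots_led L \<kappa> \<omega> P) \<le> blocks_created L \<kappa> ?tr P"
    unfolding blocks_created_eq_card[OF L] by (intro card_mono) auto
  with blocks_created_le[OF L] show ?thesis by (intro antisym)
qed

section \<open>Payoffs as random variables on the coins\<close>

lemma integrable_pmf_bounded:
  fixes f :: "'a \<Rightarrow> real"
  assumes "\<And>x. x \<in> set_pmf p \<Longrightarrow> \<bar>f x\<bar> \<le> C"
  shows "integrable (measure_pmf p) f"
  using assms by (intro measure_pmf.integrable_const_bound[where B = C]) (auto simp: AE_measure_pmf_iff)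

theorem theorem11:
  fixes L :: "('p::finite, 'd, 'x, 'i, 'r) ledger"
    and R \<alpha> x_max x_min total_stake deposit :: real
    and party_stake :: "'p \<Rightarrow> real"
    and \<beta> :: "nat \<Rightarrow> 'p \<Rightarrow> real"
    and \<Delta> :: "nat \<Rightarrow> nat set"
    and IP :: "nat \<Rightarrow> ('p, 'd, 'x, 'i) trace \<Rightarrow> 'p \<Rightarrow> bool"
    and attack :: "nat \<Rightarrow> ('p, 'd, 'x, 'i) trace \<Rightarrow> bool"
    and S_IP :: "('p, 'd, 'x, 'i, 'r) strategy"
    and X :: "nat \<Rightarrow> ('p \<Rightarrow> ('p, 'd, 'x, 'i, 'r) strategy) \<Rightarrow> ('p, 'd, 'x, 'i) trace \<Rightarrow> real"
    and B G :: "nat \<Rightarrow> 'p \<Rightarrow> ('p \<Rightarrow> ('p, 'd, 'x, 'i, 'r) strategy) \<Rightarrow>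
                  ('p, 'd, 'x, 'i) trace \<Rightarrow> real"
  assumes "ledger_protocol L"
    and "router L = sync_router"
    and "R \<ge> 0"
    and "honest_execution_assumptions L R"
    and "total_stake \<ge> 0"
    and "\<And>P. party_stake P = mu L P * total_stake"
    and "infraction_predicate L \<Delta> IP"
    and "infraction_strategy L \<Delta> IP S_IP"
    and "security_threshold L S_IP attack \<alpha>"
    and "0 \<le> x_min" and "x_min < x_max"
    and "\<And>\<kappa> \<sigma> tr. \<sigma> \<in> profiles (strategies L) \<Longrightarrow>
           X \<kappa> \<sigma> tr = (if (\<Sum>P\<in>{P. IP \<kappa> tr P}. mu L P) < \<alpha> then x_max else x_min)"
    and "\<And>\<kappa> P. \<beta> \<kappa> P \<ge> 0"
    and "\<And>\<kappa> P \<sigma> tr. \<sigma> \<in> profiles (strategies L) \<Longrightarrow>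
           B \<kappa> P \<sigma> tr = (if IP \<kappa> tr P then \<beta> \<kappa> P else 0)"
    and "deposit > 0"
    and "\<And>\<kappa> P \<sigma> tr. \<sigma> \<in> profiles (strategies L) \<Longrightarrow>
           G \<kappa> P \<sigma> tr = (if IP \<kappa> tr P then 0 else mu L P * deposit)"
    and "\<And>P. mu L P < \<alpha>"
    and "\<And>P. \<exists>\<nu>. negl \<nu> \<and> (\<forall>\<kappa>. \<beta> \<kappa> P - mu L P * deposit * x_max \<le> \<nu> \<kappa>)"
  shows "\<exists>\<nu>. negl \<nu> \<and>
           (\<forall>\<kappa>. price_of_stability (strategies L) (accountable_reward L party_stake R X B G) \<kappa>
                 \<le> 1 + \<nu> \<kappa>)"
proof -
  note L = assms(1) and honest = assms(4) and IP = assms(7)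
    and X = assms(12) and B = assms(14) and G = assms(16)
  let ?U = "accountable_reward L party_stake R X B G"
  let ?tr = "\<lambda>\<kappa> \<sigma> \<omega>. execution L \<kappa> \<sigma> \<omega>"
  have x_max: "x_max > 0" and \<alpha>: "0 < \<alpha>"
    using assms(9-11) by (auto simp: security_threshold_def)
  have mu: "0 \<le> mu L P" "(\<Sum>P\<in>UNIV. mu L P) = 1" for P
    using L by (auto simp: ledger_protocol_def)
  have stake: "0 \<le> party_stake P" for P
    using assms(5,6) mu by simp
  have honest_prof: "all_honest L \<in> profiles (strategies L)"
    using L by (auto simp: ledger_protocol_def profiles_def)
  \<comment> \<open>Traces of different profiles have different distributions. As a function of the
    coins, the payoff can be compared between profiles for the same \<omega>.\<close>
  define payoff where "payoff \<kappa> \<sigma> P \<omega> =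
    party_stake P * X \<kappa> \<sigma> (?tr \<kappa> \<sigma> \<omega>) + block_rewards L R \<kappa> (?tr \<kappa> \<sigma> \<omega>) P * X \<kappa> \<sigma> (?tr \<kappa> \<sigma> \<omega>)
    + B \<kappa> P \<sigma> (?tr \<kappa> \<sigma> \<omega>) + G \<kappa> P \<sigma> (?tr \<kappa> \<sigma> \<omega>) * X \<kappa> \<sigma> (?tr \<kappa> \<sigma> \<omega>)" for \<kappa> \<sigma> P \<omega>
  \<comment> \<open>The payoff at the top exchange rate with a block in every slot led and the full
    deposit returned, without a bribe.\<close>
  define best where "best \<kappa> P \<omega> =
    x_max * (party_stake P + real (card (slots_led L \<kappa> \<omega> P)) * R + mu L P * deposit)" for \<kappa> P \<omega>
  have X_bound: "0 \<le> X \<kappa> \<sigma> tr" "X \<kappa> \<sigma> tr \<le> x_max"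
    if "\<sigma> \<in> profiles (strategies L)" for \<kappa> \<sigma> tr
    using X[OF that] assms(10,11) by auto
  have G_bound: "0 \<le> G \<kappa> P \<sigma> tr" "G \<kappa> P \<sigma> tr \<le> mu L P * deposit"
    if "\<sigma> \<in> profiles (strategies L)" for \<kappa> \<sigma> tr P
    using G[OF that] mu(1)[of P] assms(15) by auto
  have rewards_le: "block_rewards L R \<kappa> (?tr \<kappa> \<sigma> \<omega>) P \<le> real (card (slots_led L \<kappa> \<omega> P)) * R"
    for \<kappa> \<sigma> \<omega> P
    unfolding block_rewards_def
    using blocks_created_le[OF L] assms(3) by (intro mult_right_mono) auto
  \<comment> \<open>Unlike the previous bound, this one is uniform in \<omega>, as integrability
    requires.\<close>
  have rewards_le': "block_rewards L R \<kappa> (?tr \<kappa> \<sigma> \<omega>) P \<le> real (slots L \<kappa>) * R" for \<kappa> \<sigma> \<omega> P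
    using order_trans[OF rewards_le mult_right_mono[OF _ assms(3)]] card_slots_led_le
    by (metis of_nat_le_iff)
  have rewards_nonneg: "0 \<le> block_rewards L R \<kappa> tr P" for \<kappa> tr P
    using assms(3) by (simp add: block_rewards_def)

  \<comment> \<open>The utility is a sum of four expectations; merging them into one requires each
    summand to be integrable.\<close>
  have U: "?U \<kappa> \<sigma> P = measure_pmf.expectation (coins L \<kappa>) (payoff \<kappa> \<sigma> P)"
    and integrable_payoff: "integrable (measure_pmf (coins L \<kappa>)) (payoff \<kappa> \<sigma> P)"
    if \<sigma>: "\<sigma> \<in> profiles (strategies L)" for \<kappa> \<sigma> P
  proof -
    let ?X = "\<lambda>\<omega>. X \<kappa> \<sigma> (?tr \<kappa> \<sigma> \<omega>)"
    have i: "integrable (measure_pmf (coins L \<kappa>)) (\<lambda>\<omega>. party_stake P * ?X \<omega>)"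
      using X_bound[OF \<sigma>] by (intro integrable_mult_right integrable_pmf_bounded[where C = x_max]) auto
    have "\<bar>block_rewards L R \<kappa> (?tr \<kappa> \<sigma> \<omega>) P * ?X \<omega>\<bar> \<le> real (slots L \<kappa>) * R * x_max" for \<omega>
      using X_bound[OF \<sigma>] rewards_le' rewards_nonneg assms(3)
      by (auto simp: abs_mult intro!: mult_mono)
    then have ii: "integrable (measure_pmf (coins L \<kappa>))
        (\<lambda>\<omega>. block_rewards L R \<kappa> (?tr \<kappa> \<sigma> \<omega>) P * ?X \<omega>)"
      by (rule integrable_pmf_bounded)
    have "\<bar>B \<kappa> P \<sigma> (?tr \<kappa> \<sigma> \<omega>)\<bar> \<le> \<beta> \<kappa> P" for \<omega>
      using B[OF \<sigma>] assms(13) by auto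
    then have iii: "integrable (measure_pmf (coins L \<kappa>)) (\<lambda>\<omega>. B \<kappa> P \<sigma> (?tr \<kappa> \<sigma> \<omega>))"
      by (rule integrable_pmf_bounded)
    have "\<bar>G \<kappa> P \<sigma> (?tr \<kappa> \<sigma> \<omega>) * ?X \<omega>\<bar> \<le> mu L P * deposit * x_max" for \<omega>
      using X_bound[OF \<sigma>] G_bound[OF \<sigma>] mu(1)[of P] assms(15)
      by (auto simp: abs_mult intro!: mult_mono)
    then have iv: "integrable (measure_pmf (coins L \<kappa>)) (\<lambda>\<omega>. G \<kappa> P \<sigma> (?tr \<kappa> \<sigma> \<omega>) * ?X \<omega>)"
      by (rule integrable_pmf_bounded)
    show "integrable (measure_pmf (coins L \<kappa>)) (payoff \<kappa> \<sigma> P)"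
      unfolding payoff_def
      by (intro Bochner_Integration.integrable_add i ii iii iv)
    show "?U \<kappa> \<sigma> P = measure_pmf.expectation (coins L \<kappa>) (payoff \<kappa> \<sigma> P)"
      unfolding accountable_reward_def payoff_def trace_pmf_def integral_map_pmf
      by (simp only: Bochner_Integration.integral_add Bochner_Integration.integrable_add i ii iii iv)
  qed

  have "\<forall>P. \<exists>\<nu>. negl \<nu> \<and> (\<forall>\<kappa>. \<beta> \<kappa> P - mu L P * deposit * x_max \<le> \<nu> \<kappa>)"
    using assms(18) by blast
  then obtain \<nu> where \<nu>: "\<And>P. negl (\<nu> P)"
      "\<And>P \<kappa>. \<beta> \<kappa> P - mu L P * deposit * x_max \<le> \<nu> P \<kappa>"
    by metis

  have payoff_le: "payoff \<kappa> \<sigma> P \<omega> \<le> best \<kappa> P \<omega> + \<bar>\<nu> P \<kappa>\<bar>"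
    if \<sigma>: "\<sigma> \<in> profiles (strategies L)" for \<kappa> \<sigma> P \<omega>
  proof -
    let ?t = "?tr \<kappa> \<sigma> \<omega>"
    have "party_stake P * X \<kappa> \<sigma> ?t \<le> party_stake P * x_max"
      using X_bound[OF \<sigma>] stake by (intro mult_left_mono)
    moreover have "block_rewards L R \<kappa> ?t P * X \<kappa> \<sigma> ?t
        \<le> real (card (slots_led L \<kappa> \<omega> P)) * R * x_max"
      using X_bound[OF \<sigma>] rewards_le rewards_nonneg assms(3) by (intro mult_mono) auto
    \<comment> \<open>Bribe and deposit are bounded jointly because they exclude each other: after
      an infraction only \<beta> is paid, which exceeds the deposit at rate \<open>x_max\<close> by
      at most \<nu>; otherwise only the deposit is paid.\<close>
    moreover have "B \<kappa> P \<sigma> ?t + G \<kappa> P \<sigma> ?t * X \<kappa> \<sigma> ?t \<le> mu L P * deposit * x_max + \<bar>\<nu> P \<kappa>\<bar>"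
    proof (cases "IP \<kappa> ?t P")
      case True
      then show ?thesis using B[OF \<sigma>] G[OF \<sigma>] \<nu>(2)[of \<kappa> P] by auto
    next
      case False
      have "mu L P * deposit * X \<kappa> \<sigma> ?t \<le> mu L P * deposit * x_max"
        using X_bound[OF \<sigma>] mu(1)[of P] assms(15) by (intro mult_left_mono) auto
      with False show ?thesis using B[OF \<sigma>] G[OF \<sigma>] by auto
    qed
    ultimately show ?thesis
      unfolding payoff_def best_def by (simp add: algebra_simps)
  qed

  have payoff_honest: "payoff \<kappa> (all_honest L) P \<omega> = best \<kappa> P \<omega>"
    if \<omega>: "\<omega> \<in> set_pmf (coins L \<kappa>)" for \<kappa> P \<omega>
  proof -
    \<comment> \<open>With no infractions, the power of the offenders is an empty sum, which lies
      below \<alpha>; hence the exchange rate is \<open>x_max\<close>.\<close>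
    have "\<not> IP \<kappa> (?tr \<kappa> (all_honest L) \<omega>) Q" for Q
      using IP honest_prof \<omega> unfolding infraction_predicate_def by blast
    then show ?thesis
      unfolding payoff_def best_def block_rewards_def
      using \<alpha> X[OF honest_prof] B[OF honest_prof] G[OF honest_prof]
        blocks_created_honest[OF L honest \<omega>]
      by (simp add: algebra_simps)
  qed

  show ?thesis
  \<comment> \<open>Absolute values are taken because \<nu> may be negative, whereas the errors have
    to be nonnegative.\<close>
  proof (rule price_of_stability_le[where c = "x_max * deposit" and \<epsilon> = "\<lambda>P \<kappa>. \<bar>\<nu> P \<kappa>\<bar>"])
    show "all_honest L \<in> profiles (strategies L)" by (rule honest_prof)
    show "?U \<kappa> \<sigma> P \<le> ?U \<kappa> (all_honest L) P + \<bar>\<nu> P \<kappa>\<bar>"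
      if \<sigma>: "\<sigma> \<in> profiles (strategies L)" for \<kappa> \<sigma> P
    proof -
      have "?U \<kappa> \<sigma> P \<le> measure_pmf.expectation (coins L \<kappa>)
          (\<lambda>\<omega>. payoff \<kappa> (all_honest L) P \<omega> + \<bar>\<nu> P \<kappa>\<bar>)"
        unfolding U[OF \<sigma>] using payoff_le[OF \<sigma>] payoff_honest
        by (intro integral_mono_AE integrable_payoff \<sigma> honest_prof
            Bochner_Integration.integrable_add) (auto simp: AE_measure_pmf_iff)
      also have "\<dots> = ?U \<kappa> (all_honest L) P + \<bar>\<nu> P \<kappa>\<bar>"
        by (simp add: U[OF honest_prof] integrable_payoff[OF honest_prof])
      finally show ?thesis .
    qed
    show "negl (\<lambda>\<kappa>. \<bar>\<nu> P \<kappa>\<bar>)" for P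
      using \<nu>(1) by (rule negl_abs)
    show "0 \<le> \<bar>\<nu> P \<kappa>\<bar>" for P \<kappa> by simp
    show "x_max * deposit > 0" using x_max assms(15) by simp
    \<comment> \<open>Only the deposit term of \<open>best\<close> is kept, since stake and block
      rewards are nonnegative. The deposit shares add up to the whole deposit because the powers sum
      to 1.\<close>
    show "x_max * deposit \<le> welfare ?U \<kappa> (all_honest L)" for \<kappa>
    proof -
      have "x_max * deposit * mu L P \<le> ?U \<kappa> (all_honest L) P" for P
      proof -
        have "x_max * deposit * mu L P \<le> best \<kappa> P \<omega>" for \<omega>
          using x_max stake[of P] assms(3) by (simp add: best_def algebra_simps)
        then have "measure_pmf.expectation (coins L \<kappa>) (\<lambda>\<omega>. x_max * deposit * mu L P)
            \<le> ?U \<kappa> (all_honest L) P"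
          unfolding U[OF honest_prof] using payoff_honest
          by (intro integral_mono_AE integrable_payoff honest_prof)
            (auto simp: AE_measure_pmf_iff)
        then show ?thesis by simp
      qed
      then have "(\<Sum>P\<in>UNIV. x_max * deposit * mu L P) \<le> welfare ?U \<kappa> (all_honest L)"
        unfolding welfare_def by (intro sum_mono)
      then show ?thesis by (simp add: sum_distrib_left[symmetric] mu(2))
    qed
  qed
qed

end
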